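(* Let $G=(V,E)$ be a connected unweighted graph and let $S\subseteq V$ be a nonempty set with $S\neq V$. Then a node $u^{\star}\in V\setminus S$ with the highest marginal gain $c(S\cup\{u\})-c(S)$ with respect to $S$ is given by $$u^{\star}=\arg\max_{u\in V\setminus S}\ \sum_{i=0}^{\mathsf{maxD}(u)} \bigl|B_i(u)\otimes \lnot B_i(S)\bigr|,$$ where $\mathsf{maxD}(u):=\max\{i\ge 0 : |B_i(u)\otimes\lnot B_i(S)|>0\}$.
   Context: $V=\{1,\dots,n\}$, $d(u,v)$ is the shortest-path distance, and $d(S,v):=\min_{s\in S}d(s,v)$ for nonempty $S$. Group closeness is $c(S)=\frac{n-|S|}{\sum_{v\notin S} d(S,v)}$. For $u\in V$ and integer $i\ge 0$, $B_i(u)$ is the length-$n$ bit vector whose $j$-th bit is $1$ iff $d(u,j)\le i$, and $B_i(S)$ is the length-$n$ bit vector whose $j$-th bit is $1$ iff $d(S,j)\le i$. $\otimes$ denotes bitwise AND, $\lnot$ bitwise NOT, and $|B|$ the number of ones in a bit vector $B$. *)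

theory Defs
  imports Complex_Main "Graph_Theory.Graph_Theory"
begin

text \<open>
  Finite simple undirected graphs are the symmetric, loop-free digraphs without parallel arcs
  of locale \<^locale>\<open>graph\<close>; every undirected edge is a pair of opposite arcs.
  The vertex set is meant to be \<open>{1..n}\<close>.
\<close>

text \<open>
  Number of arcs of a shortest path from \<open>u\<close> to \<open>v\<close>. Only meaningful if \<open>v\<close> is reachable
  from \<open>u\<close>; it then agrees with the library's \<^const>\<open>wf_digraph.\<mu>\<close> for unit weights
  (lemma \<open>hop_dist_eq_mu\<close> below).
\<close>
definition hop_dist :: "(nat, 'b) pre_digraph \<Rightarrow> nat \<Rightarrow> nat \<Rightarrow> nat" where
  "hop_dist G u v = (LEAST k. \<exists>p. pre_digraph.apath G u p v \<and> length p = k)"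

definition set_hop_dist :: "(nat, 'b) pre_digraph \<Rightarrow> nat set \<Rightarrow> nat \<Rightarrow> nat" where
  "set_hop_dist G S v = Min ((\<lambda>s. hop_dist G s v) ` S)"

text \<open>
  For \<open>S = verts G\<close> the quotient is \<open>0/0\<close>, which is \<open>0\<close> here. As a value of
  \<open>S \<union> {u}\<close> this occurs only if \<open>u\<close> is the sole vertex outside \<open>S\<close>, so it never
  influences a comparison of marginal gains.
\<close>
definition group_closeness :: "(nat, 'b) pre_digraph \<Rightarrow> nat set \<Rightarrow> real" where
  "group_closeness G S =
     (real (card (verts G)) - real (card S)) / (\<Sum>v \<in> verts G - S. real (set_hop_dist G S v))"

text \<open>
  Bit vectors are Boolean lists; list position \<open>j - 1\<close> holds the \<open>j\<close>-th bit,
  for \<open>j = 1, \<dots>, n\<close>.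
\<close>
definition node_bits :: "(nat, 'b) pre_digraph \<Rightarrow> nat \<Rightarrow> nat \<Rightarrow> bool list" where
  "node_bits G i u = map (\<lambda>j. hop_dist G u j \<le> i) [1..<Suc (card (verts G))]"

definition set_bits :: "(nat, 'b) pre_digraph \<Rightarrow> nat \<Rightarrow> nat set \<Rightarrow> bool list" where
  "set_bits G i S = map (\<lambda>j. set_hop_dist G S j \<le> i) [1..<Suc (card (verts G))]"

definition bits_and :: "bool list \<Rightarrow> bool list \<Rightarrow> bool list" where
  "bits_and = map2 (\<and>)"

definition bits_not :: "bool list \<Rightarrow> bool list" where
  "bits_not = map Not"

definition bits_ones :: "bool list \<Rightarrow> nat" where
  "bits_ones B = count_list B True"

definition new_ones :: "(nat, 'b) pre_digraph \<Rightarrow> nat set \<Rightarrow> nat \<Rightarrow> nat \<Rightarrow> nat" where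
  "new_ones G S u i = bits_ones (bits_and (node_bits G i u) (bits_not (set_bits G i S)))"

text \<open>
  The set under \<^const>\<open>Max\<close> is finite and nonempty for \<open>u \<notin> S\<close>: see lemma
  \<open>maxD_set\<close> below.
\<close>
definition maxD :: "(nat, 'b) pre_digraph \<Rightarrow> nat set \<Rightarrow> nat \<Rightarrow> nat" where
  "maxD G S u = Max {i. new_ones G S u i > 0}"

lemma graph_connected_reachable:
  assumes "graph G" "Digraph_Component.connected G" "u \<in> verts G" "v \<in> verts G"
  shows "u \<rightarrow>\<^sup>*\<^bsub>G\<^esub> v"
proof -
  interpret graph G by fact
  show ?thesis
    using symmetric_connected_imp_strongly_connected[OF sym_arcs assms(2)] assms(3,4)
    by (simp add: strongly_connected_def)
qed

lemma hop_dist_eq_mu: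
  fixes G :: "(nat, 'b) pre_digraph"
  assumes "graph G" and reach: "u \<rightarrow>\<^sup>*\<^bsub>G\<^esub> v"
  shows "wf_digraph.\<mu> G (\<lambda>_. 1) u v = ereal (real (hop_dist G u v))"
proof -
  interpret graph G by fact
  have cost: "awalk_cost (\<lambda>_. 1) p = real (length p)" for p :: "'b awalk"
    by (induction p) auto
  obtain p where p: "apath u p v" "\<mu> (\<lambda>_. 1) u v = awalk_cost (\<lambda>_. 1) p"
    using min_cost_awalk[OF reach, of "\<lambda>_. 1"] by auto
  have "hop_dist G u v = length p"
    unfolding hop_dist_def
  proof (rule Least_equality)
    show "\<exists>q. apath u q v \<and> length q = length p"
      using p(1) by blast
    show "length p \<le> k" if k: "\<exists>q. apath u q v \<and> length q = k" for k
    proof -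
      obtain q where q: "apath u q v" "length q = k" using k by blast
      have "\<mu> (\<lambda>_. 1) u v \<le> awalk_cost (\<lambda>_. 1) q"
        using q(1) by (intro min_cost_le_walk_cost awalkI_apath)
      then show ?thesis using p(2) q(2) by (simp add: cost)
    qed
  qed
  then show ?thesis using p(2) by (simp add: cost)
qed

lemma hop_dist_self: "u \<in> verts G \<Longrightarrow> hop_dist G u u = 0"
  unfolding hop_dist_def
  by (rule Least_eq_0) (auto simp: pre_digraph.apath_def pre_digraph.awalk_def
      pre_digraph.awalk_verts.simps pre_digraph.cas.simps)

lemma hop_dist_eq_0_iff:
  assumes "graph G" "Digraph_Component.connected G" "u \<in> verts G" "v \<in> verts G"
  shows "hop_dist G u v = 0 \<longleftrightarrow> u = v"
proof
  interpret graph G by fact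
  assume 0: "hop_dist G u v = 0"
  have "u \<rightarrow>\<^sup>*\<^bsub>G\<^esub> v" using graph_connected_reachable[OF assms] .
  then obtain p where "apath u p v"
    unfolding reachable_apath by blast
  then have "\<exists>q. apath u q v \<and> length q = hop_dist G u v"
    unfolding hop_dist_def by - (rule LeastI_ex, blast)
  then show "u = v" using 0 by (auto simp: apath_Nil_iff)
qed (use assms hop_dist_self in auto)

lemma new_ones_pos_iff:
  "new_ones G S u i > 0 \<longleftrightarrow>
     (\<exists>j \<in> {1..card (verts G)}. hop_dist G u j \<le> i \<and> i < set_hop_dist G S j)"
proof -
  let ?L = "[1..<Suc (card (verts G))]"
  have "map2 (\<and>) (map f xs) (map g xs) = map (\<lambda>j. f j \<and> g j) xs"
    for f g :: "nat \<Rightarrow> bool" and xs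
    by (induction xs) auto
  then have "new_ones G S u i
      = count_list (map (\<lambda>j. hop_dist G u j \<le> i \<and> \<not> set_hop_dist G S j \<le> i) ?L) True"
    by (simp add: new_ones_def bits_ones_def bits_and_def bits_not_def node_bits_def
        set_bits_def o_def del: upt_Suc)
  also have "\<dots> > 0 \<longleftrightarrow> True \<in> set (map (\<lambda>j. hop_dist G u j \<le> i \<and> \<not> set_hop_dist G S j \<le> i) ?L)"
    by (simp only: neq0_conv[symmetric] count_list_0_iff not_not)
  finally show ?thesis
    by (auto simp: not_le image_iff simp del: upt_Suc)
qed

lemma maxD_set:
  assumes "graph G" "verts G = {1..n}" "Digraph_Component.connected G"
    and "S \<subseteq> verts G" "S \<noteq> {}" "u \<in> verts G - S"
  shows "finite {i. new_ones G S u i > 0}" "{i. new_ones G S u i > 0} \<noteq> {}"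
proof -
  have "{i. new_ones G S u i > 0} \<subseteq> (\<Union>j \<in> {1..card (verts G)}. {..<set_hop_dist G S j})"
    by (auto simp: new_ones_pos_iff)
  then show "finite {i. new_ones G S u i > 0}"
    by (rule finite_subset) auto
  have "finite S" using assms(2,4) finite_subset[of S "{1..n}"] by simp
  then have "set_hop_dist G S u \<in> (\<lambda>s. hop_dist G s u) ` S"
    unfolding set_hop_dist_def using assms(5) by (intro Min_in) auto
  then obtain s where "s \<in> S" "set_hop_dist G S u = hop_dist G s u" by blast
  then have "set_hop_dist G S u > 0"
    using hop_dist_eq_0_iff[OF assms(1,3), of s u] assms(4,6) by (cases "s = u") auto
  moreover have "hop_dist G u u = 0" using assms(6) by (simp add: hop_dist_self)
  ultimately have "new_ones G S u 0 > 0"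
    unfolding new_ones_pos_iff using assms(2,6) by (intro bexI[of _ u]) simp_all
  then show "{i. new_ones G S u i > 0} \<noteq> {}" by blast
qed

end

theory Submission
  imports Defs
begin

text \<open>
  A vertex \<open>j\<close> is counted in \<open>B\<^sub>i(u) \<otimes> \<not> B\<^sub>i(S)\<close> exactly for \<open>d(u, j) \<le> i < d(S, j)\<close>. Swapping the
  two summations, the score of \<open>u\<close> is therefore the sum over all \<open>j\<close> of \<open>max 0 (d(S, j) - d(u, j))\<close>,
  the amount by which adding \<open>u\<close> to \<open>S\<close> lowers the total distance. As all sets \<open>S \<union> {u}\<close> have
  the same size, a largest score means a smallest denominator of the group closeness.
\<close>

lemma count_list_map_True: "count_list (map P xs) True = length (filter P xs)"
  by (induction xs) auto

text \<open>Replaces bit lists by sets, so that the score becomes a count of pairs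
  \<open>(i, j)\<close>. The index list has no repetitions, hence its filtered length is a
  cardinality.\<close>

lemma new_ones_eq_card:
  "new_ones G S u i = card {j \<in> {1..card (verts G)}. hop_dist G u j \<le> i \<and> i < set_hop_dist G S j}"
proof -
  let ?L = "[1..<Suc (card (verts G))]"
  let ?P = "\<lambda>j. hop_dist G u j \<le> i \<and> i < set_hop_dist G S j"
  have "map2 (\<and>) (map f xs) (map g xs) = map (\<lambda>j. f j \<and> g j) xs"
    for f g :: "nat \<Rightarrow> bool" and xs
    by (induction xs) auto
  then have "new_ones G S u i = count_list (map ?P ?L) True"
    by (simp add: new_ones_def bits_ones_def bits_and_def bits_not_def node_bits_def
        set_bits_def o_def not_le del: upt_Suc)
  also have "\<dots> = length (filter ?P ?L)"
    by (rule count_list_map_True)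
  also have "\<dots> = card (set (filter ?P ?L))"
    by (rule distinct_card[symmetric]) (simp del: upt_Suc)
  also have "set (filter ?P ?L) = {j \<in> {1..card (verts G)}. ?P j}"
    by (auto simp del: upt_Suc)
  finally show ?thesis .
qed

lemma sum_new_ones:
  assumes "finite {i. new_ones G S u i > 0}"
  shows "(\<Sum>i = 0..maxD G S u. new_ones G S u i)
    = (\<Sum>j = 1..card (verts G). set_hop_dist G S j - hop_dist G u j)"
proof -
  let ?M = "maxD G S u" and ?J = "{1..card (verts G)}"
  let ?P = "\<lambda>i j. hop_dist G u j \<le> i \<and> i < set_hop_dist G S j"
  \<comment> \<open>Cutting the sum off at \<open>maxD\<close> loses no pair: a pair satisfying
    \<open>?P\<close> makes \<open>new_ones\<close> positive at \<open>i\<close>, and finiteness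
    makes \<open>Max\<close> an upper bound.\<close>
  have le_maxD: "i \<le> ?M" if "j \<in> ?J" "?P i j" for i j
    unfolding maxD_def using assms that by (intro Max_ge) (auto simp: new_ones_pos_iff)
  have card_eq: "card {x \<in> A. Q x} = (\<Sum>x\<in>A. of_bool (Q x))" if "finite A"
    for A :: "nat set" and Q
    using that by (simp add: sum.If_cases of_bool_def Int_def)
  have "(\<Sum>i = 0..?M. new_ones G S u i) = (\<Sum>i = 0..?M. \<Sum>j\<in>?J. of_bool (?P i j))"
    by (simp only: new_ones_eq_card card_eq[OF finite_atLeastAtMost])
  also have "\<dots> = (\<Sum>j\<in>?J. \<Sum>i = 0..?M. of_bool (?P i j))"
    by (rule sum.swap)
  also have "\<dots> = (\<Sum>j\<in>?J. card {i \<in> {0..?M}. ?P i j})"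
    by (simp only: card_eq[OF finite_atLeastAtMost])
  also have "\<dots> = (\<Sum>j\<in>?J. set_hop_dist G S j - hop_dist G u j)"
  proof (rule sum.cong[OF refl])
    fix j assume "j \<in> ?J"
    \<comment> \<open>If \<open>u\<close> is no closer to \<open>j\<close> than \<open>S\<close> is,
      this interval is empty, in agreement with truncated subtraction on \<open>nat\<close>.\<close>
    then have "{i \<in> {0..?M}. ?P i j} = {hop_dist G u j..<set_hop_dist G S j}"
      using le_maxD by auto
    then show "card {i \<in> {0..?M}. ?P i j} = set_hop_dist G S j - hop_dist G u j"
      by simp
  qed
  finally show ?thesis .
qed

lemma set_hop_dist_Un_singleton:
  assumes "finite S" "S \<noteq> {}"
  shows "set_hop_dist G (S \<union> {u}) v = min (hop_dist G u v) (set_hop_dist G S v)"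
  using assms by (simp add: set_hop_dist_def)

text \<open>Serves two ends: members of a set add nothing to its total distance, and any vertex
  outside makes that total positive.\<close>

lemma set_hop_dist_eq_0_iff:
  assumes "graph G" "Digraph_Component.connected G"
    and "S \<subseteq> verts G" "finite S" "S \<noteq> {}" "v \<in> verts G"
  shows "set_hop_dist G S v = 0 \<longleftrightarrow> v \<in> S"
proof
  assume "set_hop_dist G S v = 0"
  moreover have "set_hop_dist G S v \<in> (\<lambda>s. hop_dist G s v) ` S"
    unfolding set_hop_dist_def using assms by (intro Min_in) auto
  ultimately obtain s where "s \<in> S" "hop_dist G s v = 0" by auto
  then show "v \<in> S" using hop_dist_eq_0_iff[OF assms(1,2), of s v] assms by auto
next
  assume "v \<in> S"
  then have "set_hop_dist G S v \<le> hop_dist G v v"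
    unfolding set_hop_dist_def using assms by (intro Min_le) auto
  then show "set_hop_dist G S v = 0" using hop_dist_self assms by fastforce
qed

lemma is_arg_max_finite_exists:
  fixes f :: "'a \<Rightarrow> 'b :: linorder"
  assumes "finite A" "A \<noteq> {}"
  shows "\<exists>x. is_arg_max f (\<lambda>x. x \<in> A) x"
proof -
  have "Max (f ` A) \<in> f ` A" using assms by (intro Max_in) auto
  then obtain x where "x \<in> A" "f x = Max (f ` A)" by auto
  then show ?thesis using assms by (auto simp: is_arg_max_linorder intro!: exI[of _ x])
qed

theorem theorem2:
  fixes G :: "(nat, 'b) pre_digraph" and n :: nat and S :: "nat set"
  assumes "graph G"
    and "verts G = {1..n}"
    and "Digraph_Component.connected G"
    and "S \<subseteq> verts G" and "S \<noteq> {}" and "S \<noteq> verts G"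
  shows "(\<exists>u. is_arg_max
                 (\<lambda>u. \<Sum>i = 0..maxD G S u.
                    bits_ones (bits_and (node_bits G i u) (bits_not (set_bits G i S))))
                 (\<lambda>u. u \<in> verts G - S) u)
       \<and> (\<forall>u. is_arg_max
                 (\<lambda>u. \<Sum>i = 0..maxD G S u.
                    bits_ones (bits_and (node_bits G i u) (bits_not (set_bits G i S))))
                 (\<lambda>u. u \<in> verts G - S) u
              \<longrightarrow> is_arg_max
                 (\<lambda>u. group_closeness G (S \<union> {u}) - group_closeness G S)
                 (\<lambda>u. u \<in> verts G - S) u)"
proof -
  let ?score = "\<lambda>u. \<Sum>i = 0..maxD G S u.
                    bits_ones (bits_and (node_bits G i u) (bits_not (set_bits G i S)))"
  let ?gain = "\<lambda>u. group_closeness G (S \<union> {u}) - group_closeness G S"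
  let ?V = "verts G"
  \<comment> \<open>Summing over all vertices, not only those outside \<open>T\<close>, gives every
    set the same index range, so totals can be compared termwise.\<close>
  define total where "total T = (\<Sum>v \<in> ?V. set_hop_dist G T v)" for T
  have fin: "finite ?V" "finite S"
    using assms(2,4) finite_subset by auto
  have closeness: "group_closeness G T = (real (card ?V) - real (card T)) / real (total T)"
    if "T \<subseteq> ?V" "T \<noteq> {}" for T
  proof -
    have "finite T" using that fin finite_subset by blast
    then have "total T = (\<Sum>v \<in> ?V - T. set_hop_dist G T v)"
      unfolding total_def using that fin set_hop_dist_eq_0_iff[OF assms(1,3)]
      by (intro sum.mono_neutral_right) auto
    then show ?thesis by (simp add: group_closeness_def)
  qed
  have score: "?score u + total (S \<union> {u}) = total S" if u: "u \<in> ?V - S" for u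
  proof -
    have "?score u = (\<Sum>v \<in> ?V. set_hop_dist G S v - hop_dist G u v)"
      using sum_new_ones[OF maxD_set(1)[OF assms(1-5) u]] assms(2)
      by (simp add: new_ones_def)
    then have "?score u + total (S \<union> {u})
        = (\<Sum>v \<in> ?V. (set_hop_dist G S v - hop_dist G u v) + set_hop_dist G (S \<union> {u}) v)"
      by (simp add: total_def sum.distrib)
    \<comment> \<open>Termwise this is \<open>(a - b) + min b a = a\<close>, which holds for
      truncated subtraction in both cases.\<close>
    also have "\<dots> = total S"
      unfolding total_def
      by (rule sum.cong[OF refl], subst set_hop_dist_Un_singleton[OF fin(2) assms(5)]) simp
    finally show ?thesis .
  qed
  have gain_mono: "?gain w \<le> ?gain u"
    if u: "u \<in> ?V - S" and w: "w \<in> ?V - S" and le: "?score w \<le> ?score u" for u w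
  proof -
    have card_Suc: "card (S \<union> {x}) = Suc (card S)" if "x \<in> ?V - S" for x
      using that fin by simp
    have sub: "S \<union> {u} \<subseteq> ?V" "S \<union> {w} \<subseteq> ?V" using u w assms(4) by auto
    have total_le: "total (S \<union> {u}) \<le> total (S \<union> {w})"
      using score[OF u] score[OF w] le by linarith
    have card_le: "card (S \<union> {u}) \<le> card ?V"
      using sub fin by (intro card_mono) auto
    have "(real (card ?V) - real (Suc (card S))) / real (total (S \<union> {w}))
        \<le> (real (card ?V) - real (Suc (card S))) / real (total (S \<union> {u}))"
    proof (cases "S \<union> {u} = ?V")
      \<comment> \<open>Here \<open>u\<close> is the only vertex outside \<open>S\<close>: the
        numerator vanishes and both quotients are 0, whatever the denominators.\<close>
      case True
      then have "card ?V = Suc (card S)" using card_Suc[OF u] by simp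
      then show ?thesis by simp
    next
      case False
      \<comment> \<open>The uncovered vertex \<open>v\<close> makes the smaller denominator
        positive, as monotonicity of division requires.\<close>
      then obtain v where v: "v \<in> ?V" "v \<notin> S \<union> {u}" using sub by blast
      have "0 < set_hop_dist G (S \<union> {u}) v"
        using set_hop_dist_eq_0_iff[OF assms(1,3) sub(1) _ _ v(1)] v(2) fin by simp
      also have "\<dots> \<le> total (S \<union> {u})"
        unfolding total_def using v fin by (intro member_le_sum) auto
      finally show ?thesis
        using total_le card_le card_Suc[OF u] by (intro divide_left_mono) auto
    qed
    then show ?thesis
      using closeness[OF sub(1)] closeness[OF sub(2)] card_Suc[OF u] card_Suc[OF w] by simp
  qed
  have "\<exists>u. is_arg_max ?score (\<lambda>u. u \<in> ?V - S) u"
    using fin assms(4,6) by (intro is_arg_max_finite_exists) auto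
  moreover have "is_arg_max ?gain (\<lambda>u. u \<in> ?V - S) u"
    if "is_arg_max ?score (\<lambda>u. u \<in> ?V - S) u" for u
    using that gain_mono unfolding is_arg_max_linorder by blast
  ultimately show ?thesis by blast
qed

end
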